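(* Let $\mathfrak g$ be a Lie algebra, let $R:\mathfrak g\to\mathfrak g$ be a modified $r$-matrix, and let $R^1_t=R+t\hat R_1$ and $R^2_t=R+t\hat R_2$ be two equivalent one-parameter infinitesimal deformations of $R$. Then $\hat R_1$ and $\hat R_2$ are in the same cohomology class of $H^2(B)$, where $B=\frac12(R-\mathrm{Id})$.
   Context: All Lie algebras are over a fixed field $\mathbb K$ of characteristic zero. A modified $r$-matrix on $\mathfrak g$ is a linear map $R:\mathfrak g\to\mathfrak g$ satisfying the modified Yang-Baxter equation $$[R(u),R(v)]_{\mathfrak g}=R([R(u),v]_{\mathfrak g})+R([u,R(v)]_{\mathfrak g})-[u,v]_{\mathfrak g},\quad \forall u,v\in\mathfrak g.$$ A Rota-Baxter operator of weight $1$ on $\mathfrak g$ is a linear map $B:\mathfrak g\to\mathfrak g$ with $[B(u),B(v)]_{\mathfrak g}=B([B(u),v]_{\mathfrak g}+[u,B(v)]_{\mathfrak g}+[u,v]_{\mathfrak g})$. A linear map $R$ is a modified $r$-matrix if and only if $B=\frac12(R-\mathrm{Id})$ is a Rota-Baxter operator of weight $1$. Cohomology of $B$: let $[u,v]_B=[B(u),v]_{\mathfrak g}+[u,B(v)]_{\mathfrak g}+[u,v]_{\mathfrak g}$; this is a Lie bracket on the vector space $\mathfrak g$, and $\theta(u)x=B([x,u]_{\mathfrak g})+[B(u),x]_{\mathfrak g}$ is a representation of $(\mathfrak g,[\cdot,\cdot]_B)$ on the vector space $\mathfrak g$. Put $C^k(B)=\mathrm{Hom}(\wedge^{k-1}\mathfrak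 g,\mathfrak g)$ for $k\ge1$, with the Chevalley-Eilenberg differential $\mathrm d^B_{CE}$ of $(\mathfrak g,[\cdot,\cdot]_B)$ with coefficients in $(\mathfrak g;\theta)$: $$\mathrm d^B_{CE}f(u_1,\dots,u_{k+1})=\sum_{i=1}^{k+1}(-1)^{i+1}\theta(u_i)f(u_1,\dots,\hat u_i,\dots,u_{k+1})+\sum_{i<j}(-1)^{i+j}f([u_i,u_j]_B,u_1,\dots,\hat u_i,\dots,\hat u_j,\dots,u_{k+1})$$ for $f\in\mathrm{Hom}(\wedge^k\mathfrak g,\mathfrak g)$. $H^k(B)$ is the $k$-th cohomology of $(C^*(B),\mathrm d^B_{CE})$, so $2$-cochains are linear maps $\mathfrak g\to\mathfrak g$. A linear map $\hat R:\mathfrak g\to\mathfrak g$ generates a one-parameter infinitesimal deformation $R_t=R+t\hat R$ of $R$ if $R_t$ is a modified $r$-matrix for all $t\in\mathbb K$. Two such deformations $R_t^1,R_t^2$ of $R$ are equivalent if there is $x\in\mathfrak g$ such that for all $t\in\mathbb K$ the map $\mathrm{Id}_{\mathfrak g}+t\,\mathrm{ad}_x$ is a Lie algebra endomorphism of $\mathfrak g$ and $(\mathrm{Id}_{\mathfrak g}+t\,\mathrm{ad}_x)\circ R_t^1=R_t^2\circ(\mathrm{Id}_{\mathfrak g}+t\,\mathrm{ad}_x)$. (That two linear maps are in the same cohomology class of $H^2(B)$ means that both are $2$-cocycles and their difference is a coboundary.) *)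

theory Defs
  imports Complex_Main
begin

(* Multilinear alternating maps of k arguments are represented as functions on lists that
   vanish on every list whose length is not k, so that equality of cochains is equality of
   functions and the 0-ary cochains correspond to the vectors f []. *)
definition Hom_wedge ::
  "('k::field \<Rightarrow> 'g::ab_group_add \<Rightarrow> 'g) \<Rightarrow> ('k \<Rightarrow> 'v::ab_group_add \<Rightarrow> 'v) \<Rightarrow> nat \<Rightarrow> ('g list \<Rightarrow> 'v) set"
  where "Hom_wedge sg sv k = {f.
    (\<forall>us. length us \<noteq> k \<longrightarrow> f us = 0) \<and>
    (\<forall>us i. length us = k \<and> i < k \<longrightarrow> Vector_Spaces.linear sg sv (\<lambda>u. f (us[i := u]))) \<and>
    (\<forall>us i j. length us = k \<and> i < j \<and> j < k \<and> us ! i = us ! j \<longrightarrow> f us = 0)}"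

definition omit_nth :: "nat \<Rightarrow> 'a list \<Rightarrow> 'a list"
  where "omit_nth i us = take i us @ drop (Suc i) us"

(* List positions start at 0, so the sign (-1)^(i+1) of the usual formula with arguments
   u_1, ..., u_{k+1} becomes (-1)^i, while (-1)^(i+j) is unchanged.  The arity of f need not
   be supplied: if f vanishes off lists of length k, the result vanishes off length k + 1. *)
definition CE_differential ::
  "('k::field \<Rightarrow> 'v::ab_group_add \<Rightarrow> 'v) \<Rightarrow> ('g \<Rightarrow> 'g \<Rightarrow> 'g) \<Rightarrow> ('g \<Rightarrow> 'v \<Rightarrow> 'v) \<Rightarrow>
    ('g list \<Rightarrow> 'v) \<Rightarrow> 'g list \<Rightarrow> 'v"
  where "CE_differential sv br \<theta> f us =
    (\<Sum>i<length us. sv ((-1) ^ i) (\<theta> (us ! i) (f (omit_nth i us)))) +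
    (\<Sum>j<length us. \<Sum>i<j.
       sv ((-1) ^ (i + j)) (f (br (us ! i) (us ! j) # omit_nth i (omit_nth j us))))"

locale lie_algebra = vector_space scale
  for scale :: "'k::field_char_0 \<Rightarrow> 'g::ab_group_add \<Rightarrow> 'g" +
  fixes bracket :: "'g \<Rightarrow> 'g \<Rightarrow> 'g"
  assumes linear_bracket_left: "Vector_Spaces.linear scale scale (\<lambda>u. bracket u v)"
    and linear_bracket_right: "Vector_Spaces.linear scale scale (\<lambda>v. bracket u v)"
    and bracket_self: "bracket u u = 0"
    and jacobi: "bracket u (bracket v w) + bracket v (bracket w u) + bracket w (bracket u v) = 0"
begin

definition lie_endomorphism :: "('g \<Rightarrow> 'g) \<Rightarrow> bool"
  where "lie_endomorphism \<phi> \<longleftrightarrow> Vector_Spaces.linear scale scale \<phi> \<and>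
    (\<forall>u v. \<phi> (bracket u v) = bracket (\<phi> u) (\<phi> v))"

definition modified_r_matrix :: "('g \<Rightarrow> 'g) \<Rightarrow> bool"
  where "modified_r_matrix R \<longleftrightarrow> Vector_Spaces.linear scale scale R \<and>
    (\<forall>u v. bracket (R u) (R v) = R (bracket (R u) v) + R (bracket u (R v)) - bracket u v)"

definition rota_baxter_1 :: "('g \<Rightarrow> 'g) \<Rightarrow> bool"
  where "rota_baxter_1 B \<longleftrightarrow> Vector_Spaces.linear scale scale B \<and>
    (\<forall>u v. bracket (B u) (B v) = B (bracket (B u) v + bracket u (B v) + bracket u v))"

definition rb_of_r_matrix :: "('g \<Rightarrow> 'g) \<Rightarrow> 'g \<Rightarrow> 'g"
  where "rb_of_r_matrix R u = scale (1 / 2) (R u - u)"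

definition affine_family :: "('g \<Rightarrow> 'g) \<Rightarrow> ('g \<Rightarrow> 'g) \<Rightarrow> 'k \<Rightarrow> 'g \<Rightarrow> 'g"
  where "affine_family R R' t u = R u + scale t (R' u)"

definition generates_deformation :: "('g \<Rightarrow> 'g) \<Rightarrow> ('g \<Rightarrow> 'g) \<Rightarrow> bool"
  where "generates_deformation R R' \<longleftrightarrow> Vector_Spaces.linear scale scale R' \<and>
    (\<forall>t. modified_r_matrix (affine_family R R' t))"

definition equivalent_deformations :: "('k \<Rightarrow> 'g \<Rightarrow> 'g) \<Rightarrow> ('k \<Rightarrow> 'g \<Rightarrow> 'g) \<Rightarrow> bool"
  where "equivalent_deformations R1 R2 \<longleftrightarrow>
    (\<exists>x. \<forall>t. let \<phi> = affine_family id (bracket x) t in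
       lie_endomorphism \<phi> \<and> \<phi> \<circ> R1 t = R2 t \<circ> \<phi>)"

definition bracket_rb :: "('g \<Rightarrow> 'g) \<Rightarrow> 'g \<Rightarrow> 'g \<Rightarrow> 'g"
  where "bracket_rb B u v = bracket (B u) v + bracket u (B v) + bracket u v"

definition rep_rb :: "('g \<Rightarrow> 'g) \<Rightarrow> 'g \<Rightarrow> 'g \<Rightarrow> 'g"
  where "rep_rb B u x = B (bracket x u) + bracket (B u) x"

(* The complex lives in degrees k >= 1 and its k-cochains have k - 1 arguments;
   degree 0 is the zero space. *)
definition rb_cochains :: "nat \<Rightarrow> ('g list \<Rightarrow> 'g) set"
  where "rb_cochains k = (if k = 0 then {\<lambda>_. 0} else Hom_wedge scale scale (k - 1))"

definition rb_differential :: "('g \<Rightarrow> 'g) \<Rightarrow> ('g list \<Rightarrow> 'g) \<Rightarrow> 'g list \<Rightarrow> 'g"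
  where "rb_differential B = CE_differential scale (bracket_rb B) (rep_rb B)"

definition rb_cocycles :: "('g \<Rightarrow> 'g) \<Rightarrow> nat \<Rightarrow> ('g list \<Rightarrow> 'g) set"
  where "rb_cocycles B k = {f \<in> rb_cochains k. rb_differential B f = (\<lambda>_. 0)}"

definition rb_coboundaries :: "('g \<Rightarrow> 'g) \<Rightarrow> nat \<Rightarrow> ('g list \<Rightarrow> 'g) set"
  where "rb_coboundaries B k =
    (if k = 0 then {\<lambda>_. 0} else rb_differential B ` rb_cochains (k - 1))"

definition rb_cohomologous :: "('g \<Rightarrow> 'g) \<Rightarrow> nat \<Rightarrow> (('g list \<Rightarrow> 'g) \<times> ('g list \<Rightarrow> 'g)) set"
  where "rb_cohomologous B k = {(f, g). f \<in> rb_cocycles B k \<and> g \<in> rb_cocycles B k \<and>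
    (\<lambda>us. f us - g us) \<in> rb_coboundaries B k}"

definition rb_cohomology :: "('g \<Rightarrow> 'g) \<Rightarrow> nat \<Rightarrow> ('g list \<Rightarrow> 'g) set set"
  where "rb_cohomology B k = rb_cocycles B k // rb_cohomologous B k"

lemma rota_baxter_iff_modified_r_matrix:
  "modified_r_matrix R \<longleftrightarrow> Vector_Spaces.linear scale scale R \<and> rota_baxter_1 (rb_of_r_matrix R)"
proof (cases "Vector_Spaces.linear scale scale R")
  case False then show ?thesis by (simp add: modified_r_matrix_def)
next
  case True
  interpret R: Vector_Spaces.linear scale scale R by fact
  interpret l: Vector_Spaces.linear scale scale "\<lambda>u. bracket u v" for v by (rule linear_bracket_left)
  interpret r: Vector_Spaces.linear scale scale "\<lambda>v. bracket u v" for u by (rule linear_bracket_right)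
  have lin: "Vector_Spaces.linear scale scale (rb_of_r_matrix R)"
    by unfold_locales (auto simp: rb_of_r_matrix_def R.add R.scale algebra_simps scale_left_commute)
  have "bracket (rb_of_r_matrix R u) (rb_of_r_matrix R v) = rb_of_r_matrix R (bracket (rb_of_r_matrix R u) v
     + bracket u (rb_of_r_matrix R v) + bracket u v) \<longleftrightarrow>
     bracket (R u) (R v) = R (bracket (R u) v) + R (bracket u (R v)) - bracket u v" (is "?L = ?M \<longleftrightarrow> ?P = ?Q") for u v
  proof -
    have h: "x = scale (1/2) x + scale (1/2) x" for x
      using scale_left_distrib[of "1/2" "1/2" x] by simp
    have a: "scale 4 ?L = ?P - bracket (R u) v - bracket u (R v) + bracket u v"
      by (simp add: rb_of_r_matrix_def R.scale l.scale r.scale l.diff r.diff scale_right_diff_distrib)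
    have b: "bracket (rb_of_r_matrix R u) v + bracket u (rb_of_r_matrix R v) + bracket u v
        = scale (1/2) (bracket (R u) v + bracket u (R v))"
      using h[of "bracket u v"] by (simp add: rb_of_r_matrix_def R.scale l.scale r.scale l.diff r.diff algebra_simps)
    have c: "scale 4 ?M = R (bracket (R u) v) + R (bracket u (R v)) - bracket (R u) v - bracket u (R v)"
      unfolding b by (simp add: rb_of_r_matrix_def R.scale R.add algebra_simps)
    have "?L = ?M \<longleftrightarrow> scale 4 ?L = scale 4 ?M" by simp
    also have "\<dots> \<longleftrightarrow> ?P = ?Q" unfolding a c by (auto simp: algebra_simps)
    finally show ?thesis .
  qed
  then show ?thesis using lin True by (auto simp: modified_r_matrix_def rota_baxter_1_def)
qed

end

definition cochain_of_map :: "('g \<Rightarrow> 'v::zero) \<Rightarrow> 'g list \<Rightarrow> 'v"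
  where "cochain_of_map f us = (if length us = 1 then f (hd us) else 0)"

lemma cochain_of_map_in_rb_cochains:
  assumes "lie_algebra scale bracket" and "Vector_Spaces.linear scale scale f"
  shows "cochain_of_map f \<in> lie_algebra.rb_cochains scale 2"
proof -
  interpret lie_algebra scale bracket by fact
  have "(\<lambda>u. cochain_of_map f (us[i := u])) = f" if "length us = 1" "i < 1" for us i
    using that by (cases us) (auto simp: cochain_of_map_def)
  then show ?thesis
    using assms(2) by (auto simp: rb_cochains_def Hom_wedge_def) (auto simp: cochain_of_map_def)
qed

end

theory Submission imports Defs begin

text \<open>
  Everything is read off from the coefficients of \<open>t\<close>. In the modified Yang-Baxter equation for
  \<open>R + t R'\<close> the coefficient of \<open>t\<close> is, after the substitution \<open>R = 2 B + Id\<close>, twice the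
  Chevalley-Eilenberg differential of \<open>R'\<close>, so a map that generates a deformation is a 2-cocycle
  (\<open>deformation_imp_cocycle\<close>). In the equation
  \<open>(Id + t ad x) (R + t R1) = (R + t R2) (Id + t ad x)\<close> the coefficient of \<open>t\<close> says
  \<open>R1 - R2 = R ad x - ad x R\<close>. The differential of a vector \<open>w\<close>, a cochain without arguments, is
  the map \<open>u \<mapsto> \<theta>(u) w\<close>, which equals half the commutator \<open>R ad w - ad w R\<close>; hence \<open>R1 - R2\<close> is
  the differential of \<open>2 x\<close> (\<open>equivalent_deformations_imp_coboundary\<close>).

  Both coefficients belong to polynomials of degree at most two in \<open>t\<close> whose constant term
  vanishes, so the values at \<open>1\<close> and \<open>- 1\<close> determine them in characteristic zero
  (\<open>linear_coefficient_zero\<close>).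
\<close>

section \<open>Chevalley-Eilenberg differentials in low degree\<close>

definition cochain_of_vector :: "'v::zero \<Rightarrow> 'g list \<Rightarrow> 'v"
  where "cochain_of_vector w us = (if us = [] then w else 0)"

lemma length_omit_nth: "i < length us \<Longrightarrow> length (omit_nth i us) = length us - 1"
  by (simp add: omit_nth_def)

lemma CE_differential_of_vector:
  assumes "vector_space sv" and zero: "\<And>u. \<theta> u 0 = 0"
  shows "CE_differential sv br \<theta> (cochain_of_vector w) = cochain_of_map (\<lambda>u. \<theta> u w)"
proof
  interpret vector_space sv by fact
  fix us
  show "CE_differential sv br \<theta> (cochain_of_vector w) us = cochain_of_map (\<lambda>u. \<theta> u w) us"
  proof (cases "length us = 1")
    case True
    then obtain u where "us = [u]" by (auto simp: length_Suc_conv)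
    then show ?thesis
      by (simp add: CE_differential_def cochain_of_vector_def cochain_of_map_def omit_nth_def)
  next
    case False
    then have "cochain_of_vector w (omit_nth i us) = 0" if "i < length us" for i
      using that length_omit_nth[OF that] by (auto simp: cochain_of_vector_def)
    then show ?thesis
      using False by (simp add: CE_differential_def zero cochain_of_map_def)
        (simp add: cochain_of_vector_def)
  qed
qed

lemma CE_differential_of_map:
  assumes "vector_space sv" and zero: "\<And>u. \<theta> u 0 = 0"
  shows "CE_differential sv br \<theta> (cochain_of_map f) us =
    (if length us = 2
     then \<theta> (us ! 0) (f (us ! 1)) - \<theta> (us ! 1) (f (us ! 0)) - f (br (us ! 0) (us ! 1))
     else 0)"
proof -
  interpret vector_space sv by fact
  show ?thesis
  proof (cases "length us = 2")
    case True
    then obtain u v where "us = [u, v]" by (auto simp: length_Suc_conv numeral_2_eq_2)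
    then show ?thesis
      by (simp add: CE_differential_def cochain_of_map_def omit_nth_def numeral_2_eq_2
          lessThan_Suc)
  next
    case False
    have "cochain_of_map f (omit_nth i us) = 0" if "i < length us" for i
      using that length_omit_nth[OF that] False by (auto simp: cochain_of_map_def)
    moreover have "cochain_of_map f (b # omit_nth i (omit_nth j us)) = 0"
      if "i < j" "j < length us" for b i j
    proof -
      have "length (omit_nth i (omit_nth j us)) = length us - 2"
        using that by (simp add: length_omit_nth)
      then show ?thesis using False that by (simp add: cochain_of_map_def)
    qed
    ultimately show ?thesis
      using False by (simp add: CE_differential_def zero)
  qed
qed

section \<open>Lie algebras and the operator B\<close>

context lie_algebra
begin

lemmas bracket_left_simps =
  module_hom.add[OF linear_bracket_left[unfolded linear_iff_module_hom]]
  module_hom.diff[OF linear_bracket_left[unfolded linear_iff_module_hom]]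
  module_hom.scale[OF linear_bracket_left[unfolded linear_iff_module_hom]]
  module_hom.zero[OF linear_bracket_left[unfolded linear_iff_module_hom]]

lemmas bracket_right_simps =
  module_hom.add[OF linear_bracket_right[unfolded linear_iff_module_hom]]
  module_hom.diff[OF linear_bracket_right[unfolded linear_iff_module_hom]]
  module_hom.scale[OF linear_bracket_right[unfolded linear_iff_module_hom]]
  module_hom.zero[OF linear_bracket_right[unfolded linear_iff_module_hom]]

lemma bracket_antisym: "bracket v u = - bracket u v"
proof -
  have "0 = bracket (u + v) (u + v)" by (simp only: bracket_self)
  also have "\<dots> = bracket u (u + v) + bracket v (u + v)" by (rule bracket_left_simps)
  also have "\<dots> = bracket u v + bracket v u" by (simp add: bracket_right_simps bracket_self)
  finally have "bracket u v + bracket v u = 0" by simp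
  then show ?thesis by (simp add: eq_neg_iff_add_eq_0 add.commute)
qed

lemma double_eq_zero_iff: "(x::'g) + x = 0 \<longleftrightarrow> x = 0"
proof -
  have "x + x = scale 2 x" using scale_left_distrib[of 1 1 x] by simp
  then show ?thesis by simp
qed

lemma linear_coefficient_zero:
  assumes "\<And>t. scale t b + scale (t * t) c = 0"
  shows "b = 0"
proof -
  have "b + c = 0" "- b + c = 0" using assms[of 1] assms[of "-1"] by simp_all
  then have "b + b = 0" by (metis add.inverse_unique add.inverse_inverse neg_eq_iff_add_eq_0)
  then show ?thesis by (simp only: double_eq_zero_iff)
qed

lemma scale_half_double: "scale (1 / 2) x + scale (1 / 2) x = x"
  using scale_left_distrib[of "1/2" "1/2" x] by simp

lemma rep_rb_zero: "Vector_Spaces.linear scale scale B \<Longrightarrow> rep_rb B u 0 = 0"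
  by (simp add: rep_rb_def bracket_left_simps bracket_right_simps
      module_hom.zero linear_iff_module_hom)

lemma linear_rb_of_r_matrix:
  "modified_r_matrix R \<Longrightarrow> Vector_Spaces.linear scale scale (rb_of_r_matrix R)"
  by (simp add: rota_baxter_iff_modified_r_matrix rota_baxter_1_def)

text \<open>The summand \<open>- Id\<close> of \<open>R - Id\<close> contributes \<open>- [w, u] - [u, w] = 0\<close>.\<close>

lemma rep_rb_of_r_matrix:
  "rep_rb (rb_of_r_matrix R) u w = scale (1 / 2) (R (bracket w u) - bracket w (R u))"
  by (simp add: rep_rb_def rb_of_r_matrix_def bracket_left_simps bracket_right_simps
      bracket_antisym[of _ w] algebra_simps)

lemma bracket_rb_of_r_matrix:
  "bracket_rb (rb_of_r_matrix R) u v = scale (1 / 2) (bracket (R u) v + bracket u (R v))"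
  using scale_half_double[of "bracket u v"]
  by (simp add: bracket_rb_def rb_of_r_matrix_def bracket_left_simps bracket_right_simps
      algebra_simps)

section \<open>Deformations are cocycles\<close>

lemma modified_r_matrix_infinitesimal:
  assumes R: "modified_r_matrix R" and R': "generates_deformation R R'"
  shows "bracket (R u) (R' v) + bracket (R' u) (R v) =
    R (bracket (R' u) v + bracket u (R' v)) + R' (bracket (R u) v + bracket u (R v))"
proof -
  interpret R: Vector_Spaces.linear scale scale R using R by (simp add: modified_r_matrix_def)
  interpret R': Vector_Spaces.linear scale scale R'
    using R' by (simp add: generates_deformation_def)
  have ybe: "bracket (R u) (R v) = R (bracket (R u) v) + R (bracket u (R v)) - bracket u v"
    using R by (simp add: modified_r_matrix_def)
  let ?b = "bracket (R u) (R' v) + bracket (R' u) (R v) -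
    R (bracket (R' u) v + bracket u (R' v)) - R' (bracket (R u) v + bracket u (R v))"
  let ?c = "bracket (R' u) (R' v) - R' (bracket (R' u) v + bracket u (R' v))"
  have "scale t ?b + scale (t * t) ?c = 0" for t
  proof -
    have "modified_r_matrix (affine_family R R' t)"
      using R' by (simp add: generates_deformation_def)
    then have "bracket (R u + scale t (R' u)) (R v + scale t (R' v)) =
      R (bracket (R u + scale t (R' u)) v) + scale t (R' (bracket (R u + scale t (R' u)) v)) +
      (R (bracket u (R v + scale t (R' v))) + scale t (R' (bracket u (R v + scale t (R' v))))) -
      bracket u v"
      by (simp add: modified_r_matrix_def affine_family_def)
    then show ?thesis
      by (simp add: bracket_left_simps bracket_right_simps R.add R.scale R'.add R'.scale ybe
          algebra_simps)
  qed
  then have "?b = 0" by (rule linear_coefficient_zero)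
  then show ?thesis by (simp add: algebra_simps)
qed

text \<open>
  Half the infinitesimal Yang-Baxter equation is the cocycle condition: the terms without \<open>R\<close> that
  \<open>B = (R - Id) / 2\<close> brings in cancel in \<open>\<theta>\<close> and in the bracket of \<open>B\<close> separately.
\<close>

lemma deformation_imp_cocycle:
  assumes R: "modified_r_matrix R" and R': "generates_deformation R R'"
  shows "cochain_of_map R' \<in> rb_cocycles (rb_of_r_matrix R) 2"
proof -
  interpret R: Vector_Spaces.linear scale scale R using R by (simp add: modified_r_matrix_def)
  interpret R': Vector_Spaces.linear scale scale R'
    using R' by (simp add: generates_deformation_def)
  let ?B = "rb_of_r_matrix R"
  have "rep_rb ?B u (R' v) - rep_rb ?B v (R' u) - R' (bracket_rb ?B u v) = 0" for u v
  proof -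
    have "rep_rb ?B u (R' v) - rep_rb ?B v (R' u) - R' (bracket_rb ?B u v) =
      scale (1 / 2) (bracket (R u) (R' v) + bracket (R' u) (R v) -
        (R (bracket (R' u) v + bracket u (R' v)) + R' (bracket (R u) v + bracket u (R v))))"
      by (simp add: rep_rb_of_r_matrix bracket_rb_of_r_matrix bracket_antisym[of _ "R' v"]
          R.neg R.add R.diff R'.add R'.scale algebra_simps)
    then show ?thesis
      by (simp add: modified_r_matrix_infinitesimal[OF R R'])
  qed
  then have "rb_differential ?B (cochain_of_map R') = (\<lambda>_. 0)"
    by (simp add: rb_differential_def fun_eq_iff
        CE_differential_of_map[where \<theta> = "rep_rb ?B", OF vector_space_axioms
          rep_rb_zero[OF linear_rb_of_r_matrix[OF R]]])
  moreover have "cochain_of_map R' \<in> rb_cochains 2"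
    by (rule cochain_of_map_in_rb_cochains[OF lie_algebra_axioms R'.linear_axioms])
  ultimately show ?thesis by (simp add: rb_cocycles_def)
qed

section \<open>Equivalent deformations are cohomologous\<close>

lemma equivalent_deformations_infinitesimal:
  assumes R: "Vector_Spaces.linear scale scale R" and R2: "Vector_Spaces.linear scale scale R2"
    and eq: "equivalent_deformations (affine_family R R1) (affine_family R R2)"
  obtains x where "\<And>u. R1 u - R2 u = R (bracket x u) - bracket x (R u)"
proof -
  interpret R: Vector_Spaces.linear scale scale R by fact
  interpret R2: Vector_Spaces.linear scale scale R2 by fact
  obtain x where x: "affine_family id (bracket x) t \<circ> affine_family R R1 t =
      affine_family R R2 t \<circ> affine_family id (bracket x) t" for t
    using eq by (auto simp: equivalent_deformations_def Let_def)
  have "R1 u - R2 u - (R (bracket x u) - bracket x (R u)) = 0" for u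
  proof (rule linear_coefficient_zero)
    fix t
    show "scale t (R1 u - R2 u - (R (bracket x u) - bracket x (R u))) +
      scale (t * t) (bracket x (R1 u) - R2 (bracket x u)) = 0"
      using fun_cong[OF x[of t], of u]
      by (simp add: affine_family_def bracket_right_simps R.add R.scale R2.add R2.scale
          algebra_simps)
  qed
  then show thesis by (intro that) simp
qed

lemma cochain_of_vector_in_rb_cochains: "cochain_of_vector w \<in> rb_cochains 1"
  by (simp add: rb_cochains_def Hom_wedge_def cochain_of_vector_def)

lemma cochain_of_rep_rb_in_rb_coboundaries:
  assumes "Vector_Spaces.linear scale scale B"
  shows "cochain_of_map (\<lambda>u. rep_rb B u w) \<in> rb_coboundaries B 2"
proof -
  have "rb_differential B (cochain_of_vector w) = cochain_of_map (\<lambda>u. rep_rb B u w)"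
    unfolding rb_differential_def
    by (intro CE_differential_of_vector vector_space_axioms rep_rb_zero assms)
  then show ?thesis
    using cochain_of_vector_in_rb_cochains[of w] by (force simp: rb_coboundaries_def)
qed

text \<open>
  By \<open>rep_rb_of_r_matrix\<close> the commutator \<open>R ad x - ad x R\<close> found above is the differential of a
  vector, up to the factor one half.
\<close>

lemma equivalent_deformations_imp_coboundary:
  assumes R: "modified_r_matrix R" and R2: "Vector_Spaces.linear scale scale R2"
    and eq: "equivalent_deformations (affine_family R R1) (affine_family R R2)"
  shows "(\<lambda>us. cochain_of_map R1 us - cochain_of_map R2 us)
    \<in> rb_coboundaries (rb_of_r_matrix R) 2"
proof -
  interpret R: Vector_Spaces.linear scale scale R using R by (simp add: modified_r_matrix_def)
  obtain x where x: "R1 u - R2 u = R (bracket x u) - bracket x (R u)" for u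
    using equivalent_deformations_infinitesimal[OF R.linear_axioms R2 eq] by blast
  \<comment> \<open>The factor 2 cancels the one half in \<open>B = (R - Id) / 2\<close>.\<close>
  have "rep_rb (rb_of_r_matrix R) u (scale 2 x) = R1 u - R2 u" for u
    by (simp add: rep_rb_of_r_matrix bracket_left_simps R.scale x
        flip: scale_right_diff_distrib)
  then have "(\<lambda>us. cochain_of_map R1 us - cochain_of_map R2 us) =
    cochain_of_map (\<lambda>u. rep_rb (rb_of_r_matrix R) u (scale 2 x))"
    by (simp add: cochain_of_map_def fun_eq_iff)
  then show ?thesis
    using cochain_of_rep_rb_in_rb_coboundaries[OF linear_rb_of_r_matrix[OF R]] by simp
qed

lemma zero_in_rb_coboundaries:
  assumes "Vector_Spaces.linear scale scale B"
  shows "(\<lambda>_. 0) \<in> rb_coboundaries B 2"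
  using cochain_of_rep_rb_in_rb_coboundaries[OF assms, of 0] rep_rb_zero[OF assms]
  by (simp add: cochain_of_map_def[abs_def])

text \<open>
  The class is the image of \<open>f\<close> under the relation. It contains \<open>f\<close> and \<open>g\<close> because
  \<open>f - f = 0\<close> and \<open>f - g\<close> are coboundaries.
\<close>

lemma cohomologous_imp_same_class:
  assumes "Vector_Spaces.linear scale scale B" and fg: "(f, g) \<in> rb_cohomologous B 2"
  shows "\<exists>c \<in> rb_cohomology B 2. f \<in> c \<and> g \<in> c"
proof
  have f: "f \<in> rb_cocycles B 2" using fg by (simp add: rb_cohomologous_def)
  then show "rb_cohomologous B 2 `` {f} \<in> rb_cohomology B 2"
    unfolding rb_cohomology_def by (rule quotientI)
  show "f \<in> rb_cohomologous B 2 `` {f} \<and> g \<in> rb_cohomologous B 2 `` {f}"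
    using f fg zero_in_rb_coboundaries[OF assms(1)] by (simp add: rb_cohomologous_def)
qed

end

theorem theorem2p19:
  fixes scale :: "'k::field_char_0 \<Rightarrow> 'g::ab_group_add \<Rightarrow> 'g"
    and bracket :: "'g \<Rightarrow> 'g \<Rightarrow> 'g"
    and R R1 R2 :: "'g \<Rightarrow> 'g"
  assumes "lie_algebra scale bracket"
    and "lie_algebra.modified_r_matrix scale bracket R"
    and "lie_algebra.generates_deformation scale bracket R R1"
    and "lie_algebra.generates_deformation scale bracket R R2"
    and "lie_algebra.equivalent_deformations scale bracket
           (lie_algebra.affine_family scale R R1) (lie_algebra.affine_family scale R R2)"
  shows "\<exists>c \<in> lie_algebra.rb_cohomology scale bracket (lie_algebra.rb_of_r_matrix scale R) 2.
           cochain_of_map R1 \<in> c \<and> cochain_of_map R2 \<in> c"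
proof -
  interpret lie_algebra scale bracket by fact
  have "Vector_Spaces.linear scale scale R2"
    using assms(4) by (simp add: generates_deformation_def)
  then have "(cochain_of_map R1, cochain_of_map R2) \<in> rb_cohomologous (rb_of_r_matrix R) 2"
    unfolding rb_cohomologous_def
    using deformation_imp_cocycle[OF assms(2,3)] deformation_imp_cocycle[OF assms(2,4)]
      equivalent_deformations_imp_coboundary[OF assms(2) _ assms(5)] by simp
  then show ?thesis
    by (rule cohomologous_imp_same_class[OF linear_rb_of_r_matrix[OF assms(2)]])
qed

end
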